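(* For any prime $p$ and any positive integer $m \geq 1$, the space $\mathbf{PG}(m,\overline{\mathbb{F}_p})$ does not admit Singer groups. In particular, this result applies to the planar case ($m = 2$).
   Context: $\overline{\mathbb{F}_p}$ is an algebraic closure of the field with $p$ elements. For a field $\mathbb{F}$, $\mathbf{PG}(m,\mathbb{F})$ is the projective space of the vector space $\mathbb{F}^{m+1}$; its points are the $1$-dimensional subspaces, and its automorphism group is $\mathbf{P\Gamma L}_{m+1}(\mathbb{F})$ (semilinear bijections modulo scalars). A Singer group is a subgroup of this automorphism group acting sharply transitively on the points (for any two points $x,y$ there is exactly one group element mapping $x$ to $y$). *)

theory Defs
  imports "HOL-Analysis.Analysis" "HOL-Algebra.Algebraic_Closure_Type"
begin

text \<open>
  The projective space of the vector space \<open>'a ^ 'n\<close>, i.e. \<open>PG(m, 'a)\<close> for \<open>CARD('n) = m + 1\<close>.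
\<close>

definition proj_points :: "('a::field ^ 'n) set set" where
  "proj_points = {P. vec.subspace P \<and> vec.dim P = 1}"

definition field_automorphism :: "('a::field \<Rightarrow> 'a) \<Rightarrow> bool" where
  "field_automorphism \<sigma> \<longleftrightarrow>
     bij \<sigma> \<and> (\<forall>x y. \<sigma> (x + y) = \<sigma> x + \<sigma> y) \<and> (\<forall>x y. \<sigma> (x * y) = \<sigma> x * \<sigma> y)"

definition semilinear :: "('a::field ^ 'n \<Rightarrow> 'a ^ 'n) \<Rightarrow> bool" where
  "semilinear f \<longleftrightarrow> (\<forall>u v. f (u + v) = f u + f v) \<and>
     (\<exists>\<sigma>. field_automorphism \<sigma> \<and> (\<forall>c v. f (c *s v) = \<sigma> c *s f v))"

definition GammaL :: "('a::field ^ 'n \<Rightarrow> 'a ^ 'n) monoid" where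
  "GammaL = \<lparr>carrier = {f. bij f \<and> semilinear f}, monoid.mult = (\<lambda>f g. f \<circ> g), one = id\<rparr>"

definition scalar_maps :: "('a::field ^ 'n \<Rightarrow> 'a ^ 'n) set" where
  "scalar_maps = {(\<lambda>v. c *s v) | c. c \<noteq> 0}"

definition PGammaL :: "('a::field ^ 'n \<Rightarrow> 'a ^ 'n) set monoid" where
  "PGammaL = GammaL Mod scalar_maps"

text \<open>
  Elements of \<^const>\<open>PGammaL\<close> are cosets of the scalars. All representatives of a coset
  map a point to the same point (lemma \<open>proj_act_coset\<close> below), so the union in the following
  definition is that common image.
\<close>

definition proj_act :: "('a::field ^ 'n \<Rightarrow> 'a ^ 'n) set \<Rightarrow> ('a ^ 'n) set \<Rightarrow> ('a ^ 'n) set" where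
  "proj_act C P = (\<Union>f\<in>C. f ` P)"

definition singer_group :: "('a::field ^ 'n \<Rightarrow> 'a ^ 'n) set set \<Rightarrow> bool" where
  "singer_group S \<longleftrightarrow> subgroup S PGammaL \<and>
     (\<forall>x\<in>proj_points. \<forall>y\<in>proj_points. \<exists>!g. g \<in> S \<and> proj_act g x = y)"

lemma field_automorphism_inv:
  assumes "field_automorphism \<sigma>"
  shows "field_automorphism (inv_into UNIV \<sigma>)"
proof -
  have b: "bij \<sigma>" and a: "\<And>x y. \<sigma> (x + y) = \<sigma> x + \<sigma> y" and m: "\<And>x y. \<sigma> (x * y) = \<sigma> x * \<sigma> y"
    using assms by (auto simp: field_automorphism_def)
  let ?t = "inv_into UNIV \<sigma>"
  have s: "\<sigma> (?t x) = x" for x using b by (simp add: bij_is_surj surj_f_inv_f)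
  have t: "?t (\<sigma> x) = x" for x using b by (simp add: bij_is_inj)
  have "?t (x + y) = ?t x + ?t y" "?t (x * y) = ?t x * ?t y" for x y
    by (metis a s t) (metis m s t)
  then show ?thesis using b by (simp add: field_automorphism_def bij_imp_bij_inv)
qed

lemma semilinear_comp:
  assumes "semilinear f" "semilinear g"
  shows "semilinear (f \<circ> g)"
proof -
  from assms obtain \<sigma> \<tau> where
    "field_automorphism \<sigma>" "\<And>c v. f (c *s v) = \<sigma> c *s f v"
    "field_automorphism \<tau>" "\<And>c v. g (c *s v) = \<tau> c *s g v"
    by (auto simp: semilinear_def)
  then have "field_automorphism (\<sigma> \<circ> \<tau>)" "\<And>c v. (f \<circ> g) (c *s v) = (\<sigma> \<circ> \<tau>) c *s (f \<circ> g) v"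
    by (auto simp: field_automorphism_def bij_comp)
  then show ?thesis using assms unfolding semilinear_def by (metis comp_apply)
qed

lemma semilinear_inv:
  assumes "semilinear f" "bij f"
  shows "semilinear (inv_into UNIV f)"
proof -
  let ?g = "inv_into UNIV f"
  from assms obtain \<sigma> where \<sigma>: "field_automorphism \<sigma>" and c: "\<And>c v. f (c *s v) = \<sigma> c *s f v"
    and a: "\<And>u v. f (u + v) = f u + f v"
    by (auto simp: semilinear_def)
  let ?t = "inv_into UNIV \<sigma>"
  have s: "\<sigma> (?t x) = x" for x
    using \<sigma> by (simp add: field_automorphism_def bij_is_surj surj_f_inv_f)
  have fg: "f (?g x) = x" and gf: "?g (f x) = x" for x
    using assms(2) by (simp_all add: bij_is_surj surj_f_inv_f bij_is_inj)
  have "?g (u + v) = ?g u + ?g v" for u v by (metis a fg gf)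
  moreover have "?g (c *s v) = ?t c *s ?g v" for c v by (metis c fg gf s)
  ultimately show ?thesis
    using field_automorphism_inv[OF \<sigma>] unfolding semilinear_def by blast
qed

lemma semilinear_scale: "semilinear (\<lambda>v. c *s v :: 'a::field ^ 'n)"
proof -
  have "field_automorphism (id :: 'a \<Rightarrow> 'a)" by (simp add: field_automorphism_def)
  moreover have "c *s (d *s v) = id d *s (c *s v)" for d and v :: "'a ^ 'n"
    by (simp add: mult.commute)
  ultimately show ?thesis unfolding semilinear_def by (metis vec.scale_right_distrib)
qed

lemma bij_scale: "c \<noteq> 0 \<Longrightarrow> bij (\<lambda>v. c *s v :: 'a::field ^ 'n)"
  by (rule o_bij[of "\<lambda>v. inverse c *s v"]) (auto simp: fun_eq_iff)

lemma group_GammaL: "group (GammaL :: ('a::field ^ 'n \<Rightarrow> _) monoid)"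
proof (rule groupI)
  show "\<one>\<^bsub>GammaL\<^esub> \<in> carrier (GammaL :: ('a ^ 'n \<Rightarrow> _) monoid)"
    using semilinear_scale[of "1 :: 'a"] bij_id by (simp add: GammaL_def id_def)
next
  fix f :: "'a ^ 'n \<Rightarrow> 'a ^ 'n" assume "f \<in> carrier GammaL"
  then show "\<exists>g\<in>carrier GammaL. g \<otimes>\<^bsub>GammaL\<^esub> f = \<one>\<^bsub>GammaL\<^esub>"
    by (intro bexI[of _ "inv_into UNIV f"])
       (auto simp: GammaL_def semilinear_inv bij_imp_bij_inv bij_is_inj)
qed (auto simp: GammaL_def semilinear_comp bij_comp)

lemma normal_scalar_maps: "scalar_maps \<lhd> (GammaL :: ('a::field ^ 'n \<Rightarrow> _) monoid)"
proof -
  interpret group "GammaL :: ('a ^ 'n \<Rightarrow> _) monoid" by (rule group_GammaL)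
  have in_c: "scalar_maps \<subseteq> carrier (GammaL :: ('a ^ 'n \<Rightarrow> _) monoid)"
    by (auto simp: scalar_maps_def GammaL_def bij_scale semilinear_scale)
  have "subgroup scalar_maps (GammaL :: ('a ^ 'n \<Rightarrow> _) monoid)"
  proof (rule subgroupI[OF in_c])
    show "scalar_maps \<noteq> ({} :: ('a ^ 'n \<Rightarrow> _) set)"
      unfolding scalar_maps_def by (auto intro: exI[of _ "1 :: 'a"])
  next
    fix f :: "'a ^ 'n \<Rightarrow> 'a ^ 'n" assume f: "f \<in> scalar_maps"
    then obtain c where c: "f = (\<lambda>v. c *s v)" "c \<noteq> 0" by (auto simp: scalar_maps_def)
    let ?g = "\<lambda>v. inverse c *s v"
    have g: "?g \<in> scalar_maps" using c by (auto simp: scalar_maps_def intro!: exI[of _ "inverse c"])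
    have "?g \<otimes>\<^bsub>GammaL\<^esub> f = \<one>\<^bsub>GammaL\<^esub>" using c by (auto simp: GammaL_def fun_eq_iff)
    then have "inv\<^bsub>GammaL\<^esub> f = ?g" using f g in_c by (intro inv_equality) auto
    then show "inv\<^bsub>GammaL\<^esub> f \<in> scalar_maps" using g by simp
  next
    fix f g :: "'a ^ 'n \<Rightarrow> 'a ^ 'n" assume "f \<in> scalar_maps" "g \<in> scalar_maps"
    then obtain c d where "f = (\<lambda>v. c *s v)" "c \<noteq> 0" "g = (\<lambda>v. d *s v)" "d \<noteq> 0"
      by (auto simp: scalar_maps_def)
    then show "f \<otimes>\<^bsub>GammaL\<^esub> g \<in> scalar_maps"
      by (auto simp: scalar_maps_def GammaL_def fun_eq_iff intro!: exI[of _ "c * d"])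
  qed
  moreover have "f \<otimes>\<^bsub>GammaL\<^esub> h \<otimes>\<^bsub>GammaL\<^esub> inv\<^bsub>GammaL\<^esub> f \<in> scalar_maps"
    if f: "f \<in> carrier GammaL" and h: "h \<in> scalar_maps" for f h :: "'a ^ 'n \<Rightarrow> 'a ^ 'n"
  proof -
    from h obtain c where c: "h = (\<lambda>v. c *s v)" "c \<noteq> 0" by (auto simp: scalar_maps_def)
    from f obtain \<sigma> where \<sigma>: "field_automorphism \<sigma>" "\<And>c v. f (c *s v) = \<sigma> c *s f v"
      by (auto simp: GammaL_def semilinear_def)
    have "\<sigma> 0 = 0" "inj \<sigma>"
      using \<sigma>(1) by (auto simp: field_automorphism_def bij_is_inj) (metis add_cancel_right_right)
    then have "\<sigma> c \<noteq> 0" using c(2) by (metis injD)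
    then have s: "(\<lambda>v. \<sigma> c *s v) \<in> scalar_maps" by (auto simp: scalar_maps_def)
    have "f \<otimes>\<^bsub>GammaL\<^esub> h = (\<lambda>v. \<sigma> c *s v) \<otimes>\<^bsub>GammaL\<^esub> f"
      by (auto simp: GammaL_def c \<sigma> fun_eq_iff)
    then have "f \<otimes>\<^bsub>GammaL\<^esub> h \<otimes>\<^bsub>GammaL\<^esub> inv\<^bsub>GammaL\<^esub> f = (\<lambda>v. \<sigma> c *s v)"
      using f subsetD[OF in_c s] by (simp add: m_assoc)
    then show ?thesis using s by simp
  qed
  ultimately show ?thesis by (simp add: normal_inv_iff)
qed

lemma group_PGammaL: "group (PGammaL :: ('a::field ^ 'n \<Rightarrow> _) set monoid)"
  unfolding PGammaL_def by (rule normal.factorgroup_is_group[OF normal_scalar_maps])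

lemma proj_act_coset:
  fixes f :: "'a::field ^ 'n \<Rightarrow> 'a ^ 'n"
  assumes f: "f \<in> carrier GammaL" and P: "P \<in> proj_points"
  shows "proj_act (scalar_maps #>\<^bsub>GammaL\<^esub> f) P = f ` P"
proof -
  from f obtain \<sigma> where \<sigma>: "field_automorphism \<sigma>" "\<And>c v. f (c *s v) = \<sigma> c *s f v"
    by (auto simp: GammaL_def semilinear_def)
  have "c *s f v \<in> f ` P" if "v \<in> P" for c v
  proof -
    obtain d where "c = \<sigma> d"
      using \<sigma>(1) unfolding field_automorphism_def by (meson bij_pointE)
    then have "c *s f v = f (d *s v)" using \<sigma>(2) by simp
    moreover have "d *s v \<in> P" using that P by (simp add: proj_points_def vec.subspace_scale)
    ultimately show ?thesis by simp
  qed
  moreover have "proj_act (scalar_maps #>\<^bsub>GammaL\<^esub> f) P = {c *s f v | c v. c \<noteq> 0 \<and> v \<in> P}"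
    unfolding proj_act_def r_coset_def scalar_maps_def GammaL_def by auto
  moreover have "f v \<in> {c *s f v | c v. c \<noteq> 0 \<and> v \<in> P}" if "v \<in> P" for v
    using that by (intro CollectI exI[of _ "1 :: 'a"] exI[of _ v]) simp
  ultimately show ?thesis by (intro equalityI subsetI) auto
qed

end

theory Submission
  imports Defs
begin

text \<open>
  Suppose that \<open>S\<close> acts sharply transitively on the points of the projective space over an
  algebraic closure \<open>F\<close> of the field with \<open>p\<close> elements. An element of \<open>S\<close> that fixes a point is the
  identity, so it is enough to show that every element of \<open>S\<close> fixes a point: then \<open>S\<close> is trivial,
  although it has to move one of two distinct points to the other.

  Represent an element of \<open>S\<close> by a semilinear bijection \<open>f\<close> with companion automorphism \<open>\<sigma>\<close>. The field
  \<open>F\<close> is the union of its finite subfields, and \<open>\<sigma>\<close> maps each of them to itself. The coordinates of a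
  vector \<open>v\<close> and the matrix entries of \<open>f\<close> lie in one finite subfield, so the orbit of \<open>v\<close> under \<open>f\<close>
  is finite (\<open>finite_orbit_semilinear\<close>). Hence a power \<open>f ^^ k\<close> with \<open>k > 0\<close> fixes a nonzero vector
  and with it a point, so it is trivial in \<open>S\<close>, that is, \<open>f ^^ k\<close> is a scalar map. Since scalar maps are
  linear, \<open>\<sigma> ^^ k\<close> is the identity.

  The Galois group of \<open>F\<close> over its prime field is the profinite completion of the integers, which is
  torsion-free (\<open>automorphism_torsion_free\<close>); so \<open>\<sigma>\<close> is the identity and \<open>f\<close> is linear. A linear
  map over an algebraically closed field has an eigenvector (\<open>eigenvector_of_funpow_scalar\<close>), and the
  line through it is a fixed point of \<open>f\<close>.
\<close>

section \<open>Finite subfields as fixed sets of Frobenius powers\<close>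

text \<open>
  In an algebraically closed field of prime characteristic \<open>p\<close> and for \<open>n > 0\<close>, this is the
  subfield with \<open>p ^ n\<close> elements. For \<open>n = 0\<close> it is the whole field.
\<close>
definition frob_fixed :: "nat \<Rightarrow> 'a::field set" where
  "frob_fixed n = {x. x ^ (CHAR('a) ^ n) = x}"

definition frob_poly :: "nat \<Rightarrow> 'a::field poly" where
  "frob_poly n = Polynomial.monom 1 (CHAR('a) ^ n) - [:0, 1:]"

context
  assumes prime_char: "Factorial_Ring.prime CHAR('a::field)"
begin

lemma frob_diff: "((x::'a) - y) ^ (CHAR('a) ^ n) = x ^ (CHAR('a) ^ n) - y ^ (CHAR('a) ^ n)"
  using freshmans_dream'[OF prime_char refl, of "x - y" y n] by (simp add: algebra_simps)

lemma frob_fixed_add: "x \<in> frob_fixed n \<Longrightarrow> y \<in> frob_fixed n \<Longrightarrow> x + y \<in> (frob_fixed n :: 'a set)"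
  using freshmans_dream'[OF prime_char refl, of x y n] by (simp add: frob_fixed_def)

lemma frob_fixed_diff: "x \<in> frob_fixed n \<Longrightarrow> y \<in> frob_fixed n \<Longrightarrow> x - y \<in> (frob_fixed n :: 'a set)"
  by (simp add: frob_fixed_def frob_diff)

lemma frob_fixed_mult: "x \<in> frob_fixed n \<Longrightarrow> y \<in> frob_fixed n \<Longrightarrow> x * y \<in> (frob_fixed n :: 'a set)"
  by (simp add: frob_fixed_def power_mult_distrib)

lemma frob_fixed_inverse: "x \<in> frob_fixed n \<Longrightarrow> inverse x \<in> (frob_fixed n :: 'a set)"
  by (simp add: frob_fixed_def power_inverse)

lemma frob_fixed_0: "0 \<in> (frob_fixed n :: 'a set)"
  using prime_gt_0_nat[OF prime_char] by (simp add: frob_fixed_def)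

lemma frob_fixed_1: "1 \<in> (frob_fixed n :: 'a set)"
  by (simp add: frob_fixed_def)

lemma frob_fixed_sum: "(\<And>i. i \<in> I \<Longrightarrow> g i \<in> frob_fixed n) \<Longrightarrow> sum g I \<in> (frob_fixed n :: 'a set)"
  by (induction I rule: infinite_finite_induct) (auto intro: frob_fixed_0 frob_fixed_add)

lemma frob_fixed_power_mult: "x \<in> frob_fixed n \<Longrightarrow> x \<in> (frob_fixed (n * k) :: 'a set)"
  by (induction k) (simp_all add: frob_fixed_def power_add power_mult)

text \<open>
  By Bezout, going \<open>b * v + gcd a b = a * u\<close> times through the Frobenius map fixes \<open>x\<close>, and
  already its first \<open>b * v\<close> rounds do; so the last \<open>gcd a b\<close> rounds fix \<open>x\<close> as well.
\<close>
lemma frob_fixed_gcd: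
  assumes "x \<in> frob_fixed a" "x \<in> frob_fixed b" "a \<noteq> 0"
  shows "x \<in> (frob_fixed (gcd a b) :: 'a set)"
proof -
  let ?q = "CHAR('a)"
  obtain u v where uv: "a * u = b * v + gcd a b"
    using bezout_nat[OF \<open>a \<noteq> 0\<close>] by blast
  have au: "x ^ (?q ^ (a * u)) = x" and bv: "x ^ (?q ^ (b * v)) = x"
    using frob_fixed_power_mult[OF assms(1)] frob_fixed_power_mult[OF assms(2)]
    by (simp_all add: frob_fixed_def)
  have "x ^ (?q ^ gcd a b) = (x ^ (?q ^ (b * v))) ^ (?q ^ gcd a b)"
    by (simp add: bv)
  also have "\<dots> = x ^ (?q ^ (a * u))"
    unfolding uv by (simp only: power_add power_mult)
  finally show ?thesis by (simp add: frob_fixed_def au)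
qed

lemma roots_frob_poly: "{x :: 'a. poly (frob_poly n) x = 0} = frob_fixed n"
  by (simp add: frob_poly_def frob_fixed_def poly_monom)

lemma degree_frob_poly:
  assumes "n > 0"
  shows "Polynomial.degree (frob_poly n :: 'a poly) = CHAR('a) ^ n"
proof -
  have "1 < CHAR('a) ^ n"
    using prime_gt_1_nat[OF prime_char] assms by (rule one_less_power)
  then show ?thesis
    unfolding frob_poly_def diff_conv_add_uminus
    by (subst degree_add_eq_left) (simp_all add: degree_monom_eq)
qed

lemma frob_poly_nonzero: "n > 0 \<Longrightarrow> frob_poly n \<noteq> (0 :: 'a poly)"
  using degree_frob_poly[of n] prime_gt_0_nat[OF prime_char] by auto

lemma finite_frob_fixed: "n > 0 \<Longrightarrow> finite (frob_fixed n :: 'a set)"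
  unfolding roots_frob_poly[symmetric] by (rule poly_roots_finite[OF frob_poly_nonzero])

lemma card_frob_fixed_le: "n > 0 \<Longrightarrow> card (frob_fixed n :: 'a set) \<le> CHAR('a) ^ n"
  using card_poly_roots_bound[OF frob_poly_nonzero] degree_frob_poly
  by (simp add: roots_frob_poly)

lemma pderiv_frob_poly: "n > 0 \<Longrightarrow> pderiv (frob_poly n :: 'a poly) = -1"
  by (simp add: frob_poly_def pderiv_diff pderiv_monom pderiv_pCons one_pCons power_0_left)

text \<open>
  The prime field already supplies as many roots of \<open>X ^ p - X\<close> as the degree admits.
\<close>
lemma frob_fixed_one: "frob_fixed 1 = (of_nat :: nat \<Rightarrow> 'a) ` {..<CHAR('a)}"
proof (rule sym, rule card_seteq)
  have "(of_nat i :: 'a) \<in> frob_fixed 1" for i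
    by (induction i) (auto intro: frob_fixed_0 frob_fixed_1 frob_fixed_add)
  then show "(of_nat :: nat \<Rightarrow> 'a) ` {..<CHAR('a)} \<subseteq> frob_fixed 1"
    by (simp add: image_subset_iff del: One_nat_def)
  have "inj_on (of_nat :: nat \<Rightarrow> 'a) {..<CHAR('a)}"
  proof (rule linorder_inj_onI')
    fix i j assume ij: "i \<in> {..<CHAR('a)}" "j \<in> {..<CHAR('a)}" "i < j"
    then have "\<not> CHAR('a) dvd j - i" by (auto dest!: dvd_imp_le)
    then have "(of_nat (j - i) :: 'a) \<noteq> 0" by (simp add: of_nat_eq_0_iff_char_dvd)
    then show "(of_nat i :: 'a) \<noteq> of_nat j" using ij by (simp add: of_nat_diff)
  qed
  then show "card (frob_fixed 1 :: 'a set) \<le> card ((of_nat :: nat \<Rightarrow> 'a) ` {..<CHAR('a)})"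
    using card_frob_fixed_le[of 1] by (simp add: card_image)
qed (simp add: finite_frob_fixed)

text \<open>
  The multiplicative group of a finite field is cyclic. That theorem speaks of ring records, so the
  set is first turned into one.
\<close>
lemma frob_fixed_generator:
  assumes "n > 0"
  obtains g where "g \<in> (frob_fixed n :: 'a set)"
    "\<And>x. x \<in> frob_fixed n \<Longrightarrow> x \<noteq> 0 \<Longrightarrow> \<exists>i. x = g ^ i"
proof -
  let ?R = "\<lparr>carrier = frob_fixed n, monoid.mult = (*), one = 1, ring.zero = 0, add = (+)\<rparr> :: 'a ring"
  have neg: "\<exists>y\<in>frob_fixed n. x + y = 0" if "x \<in> frob_fixed n" for x :: 'a
    using frob_fixed_diff[OF frob_fixed_0 that] by (intro bexI[of _ "0 - x"]) auto
  have inv: "\<exists>y\<in>frob_fixed n. x * y = 1" if "x \<in> frob_fixed n" "x \<noteq> 0" for x :: 'a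
    using frob_fixed_inverse[OF that(1)] that by (intro bexI[of _ "inverse x"]) auto
  interpret field ?R
    using neg inv
    by unfold_locales
       (auto simp: Units_def algebra_simps frob_fixed_0 frob_fixed_1 frob_fixed_add frob_fixed_mult)
  have pow: "g [^]\<^bsub>?R\<^esub> i = g ^ i" for g and i :: nat
    by (induction i) (simp_all add: mult.commute)
  obtain g where "g \<in> carrier (mult_of ?R)" "carrier (mult_of ?R) = {g [^]\<^bsub>?R\<^esub> i | i :: nat. i \<in> UNIV}"
    using finite_field_mult_group_has_gen finite_frob_fixed[OF assms] by auto
  then show ?thesis by (intro that[of g]) (auto simp: pow)
qed

end

text \<open>
  Induction on the degree: splitting off a root \<open>a\<close> as \<open>P = (X - a) * Q\<close> leaves a polynomial \<open>Q\<close>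
  that is again separable, and \<open>a\<close> is not a root of \<open>Q\<close> because the derivative of \<open>P\<close> and \<open>Q\<close>
  agree at \<open>a\<close>.
\<close>
lemma card_roots_separable:
  fixes P :: "'a::field poly"
  assumes closed: "\<And>q :: 'a poly. Polynomial.degree q > 0 \<Longrightarrow> \<exists>x. poly q x = 0"
    and "P \<noteq> 0" and "\<And>x. poly P x = 0 \<Longrightarrow> poly (pderiv P) x \<noteq> 0"
  shows "card {x. poly P x = 0} = Polynomial.degree P"
  using assms(2,3)
proof (induction "Polynomial.degree P" arbitrary: P)
  case 0
  then obtain c where "P = [:c:]" by (auto elim: degree_eq_zeroE)
  with 0 show ?case by simp
next
  case (Suc n)
  then obtain a where "poly P a = 0" using closed[of P] by auto
  then obtain Q where P: "P = [:-a, 1:] * Q" by (metis dvdE poly_eq_0_iff_dvd)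
  have "Q \<noteq> 0" using P Suc.prems by auto
  then have deg: "Polynomial.degree P = Suc (Polynomial.degree Q)"
    unfolding P by (subst degree_mult_eq) auto
  have der: "poly (pderiv P) x = poly Q x + (x - a) * poly (pderiv Q) x" for x
    unfolding P pderiv_mult by (simp add: pderiv_pCons algebra_simps)
  have "poly (pderiv Q) x \<noteq> 0" if "poly Q x = 0" for x
    using Suc.prems(2)[of x] that by (auto simp: der) (simp add: P)
  then have IH: "card {x. poly Q x = 0} = Polynomial.degree Q"
    using Suc.hyps \<open>Q \<noteq> 0\<close> deg by simp
  have "poly Q a \<noteq> 0" using Suc.prems(2)[OF \<open>poly P a = 0\<close>] by (simp add: der)
  moreover have "{x. poly P x = 0} = insert a {x. poly Q x = 0}" by (auto simp: P)
  ultimately show ?case using IH poly_roots_finite[OF \<open>Q \<noteq> 0\<close>] deg by simp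
qed

section \<open>Automorphisms of an algebraic closure of a prime field\<close>

lemma map_poly_mult_hom:
  assumes "f 0 = 0" "\<And>x y. f (x + y) = f x + f y" "\<And>x y. f (x * y) = f x * f y"
  shows "map_poly f (p * q) = map_poly f p * map_poly f (q :: 'a::field poly)"
proof -
  have "f (sum g I) = (\<Sum>i\<in>I. f (g i))" for g :: "nat \<Rightarrow> 'a" and I
    by (induction I rule: infinite_finite_induct) (simp_all add: assms)
  then show ?thesis
    by (intro poly_eqI) (simp add: coeff_map_poly coeff_mult assms)
qed

lemma poly_map_poly_hom:
  assumes "f 0 = 0" "\<And>x y. f (x + y) = f x + f y" "\<And>x y. f (x * y) = f x * f y"
  shows "poly (map_poly f q) (f x) = f (poly q (x :: 'a::field))"
  by (induction q) (simp_all add: assms map_poly_pCons)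

lemma field_automorphism_0: "field_automorphism \<sigma> \<Longrightarrow> \<sigma> (0::'a::field) = 0"
  unfolding field_automorphism_def by (metis add_cancel_right_right)

lemma field_automorphism_1:
  assumes "field_automorphism \<sigma>"
  shows "\<sigma> (1::'a::field) = 1"
proof -
  have "\<sigma> 1 * \<sigma> 1 = \<sigma> 1" using assms unfolding field_automorphism_def by (metis mult_1)
  moreover have "\<sigma> 1 \<noteq> \<sigma> 0"
    using assms by (metis bij_pointE field_automorphism_def zero_neq_one)
  ultimately show ?thesis using field_automorphism_0[OF assms] by simp
qed

lemma field_automorphism_power: "field_automorphism \<sigma> \<Longrightarrow> \<sigma> (x ^ n :: 'a::field) = \<sigma> x ^ n"
  by (induction n) (simp_all add: field_automorphism_1, simp add: field_automorphism_def)

lemma field_automorphism_of_nat: "field_automorphism \<sigma> \<Longrightarrow> \<sigma> (of_nat n :: 'a::field) = of_nat n"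
  by (induction n) (simp_all add: field_automorphism_0,
      simp add: field_automorphism_def field_automorphism_1)

text \<open>
  The polynomial whose roots are the Frobenius conjugates \<open>x, x ^ p, x ^ p\<^sup>2, ...\<close> is invariant
  under the Frobenius map, which only permutes these \<open>n\<close> roots cyclically. So its coefficients lie in
  the prime field, where \<open>\<sigma>\<close> is the identity, and \<open>\<sigma>\<close> maps roots of it to roots of it.
\<close>
lemma automorphism_conjugate:
  fixes x :: "'a::field"
  assumes "Factorial_Ring.prime CHAR('a)" and \<sigma>: "field_automorphism \<sigma>"
    and x: "x \<in> frob_fixed n" and "n > 0"
  shows "\<exists>j. \<sigma> x = x ^ (CHAR('a) ^ j)"
proof -
  define q where "q = CHAR('a)"
  have q: "q > 0" using prime_gt_0_nat[OF assms(1)] by (simp add: q_def)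
  define \<phi> :: "'a \<Rightarrow> 'a" where "\<phi> = (\<lambda>y. y ^ q)"
  have \<phi>: "\<phi> 0 = 0" "\<phi> (u + v) = \<phi> u + \<phi> v" "\<phi> (u * v) = \<phi> u * \<phi> v" for u v
    using q freshmans_dream[OF assms(1) refl, of u v]
    by (simp_all add: \<phi>_def power_mult_distrib flip: q_def)
  define g where "g i = [:-(x ^ (q ^ i)), 1:]" for i :: nat
  define P where "P = prod g {..<n}"
  have \<phi>neg: "\<phi> (-u) = - \<phi> u" for u
    using \<phi>(1) \<phi>(2)[of u "-u"] by (simp add: add_eq_0_iff2 add.commute)
  have "map_poly \<phi> (g i) = g (Suc i)" for i
    using q by (simp add: g_def map_poly_pCons \<phi>neg \<phi>(1))
               (simp add: \<phi>_def mult.commute flip: power_mult)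
  then have "map_poly \<phi> (prod g I) = (\<Prod>i\<in>I. g (Suc i))" for I
    by (induction I rule: infinite_finite_induct)
       (simp_all add: map_poly_mult_hom[of \<phi>] \<phi>, simp_all add: \<phi>_def)
  then have "map_poly \<phi> P = (\<Prod>i<n. g (Suc i))" by (simp add: P_def)
  moreover have "g 0 * (\<Prod>i<n. g (Suc i)) = P * g n"
    unfolding P_def by (metis prod.lessThan_Suc prod.lessThan_Suc_shift)
  moreover have "g n = g 0" using x by (simp add: g_def frob_fixed_def q_def)
  moreover have "g 0 \<noteq> 0" by (simp add: g_def)
  ultimately have "map_poly \<phi> P = P" by simp
  then have "\<phi> (Polynomial.coeff P i) = Polynomial.coeff P i" for i
    by (metis coeff_map_poly \<phi>(1))
  then have "Polynomial.coeff P i \<in> frob_fixed 1" for i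
    by (simp add: \<phi>_def frob_fixed_def q_def)
  then have "\<sigma> (Polynomial.coeff P i) = Polynomial.coeff P i" for i
    using frob_fixed_one[OF assms(1)] field_automorphism_of_nat[OF \<sigma>] by (metis imageE)
  then have "map_poly \<sigma> P = P"
    by (intro poly_eqI) (simp add: coeff_map_poly field_automorphism_0[OF \<sigma>])
  then have "poly P (\<sigma> x) = \<sigma> (poly P x)"
    using poly_map_poly_hom[of \<sigma> P x] \<sigma> field_automorphism_0[OF \<sigma>]
    by (simp add: field_automorphism_def)
  also have "poly P x = 0"
    using \<open>n > 0\<close> by (auto simp: P_def poly_prod g_def intro!: bexI[of _ 0])
  finally have "poly P (\<sigma> x) = 0" using field_automorphism_0[OF \<sigma>] by simp
  then show ?thesis by (auto simp: P_def poly_prod g_def q_def)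
qed

text \<open>
  To see that \<open>\<sigma>\<close> fixes an element \<open>x\<close> of the field with \<open>p ^ n\<close> elements, pass to the larger
  field with \<open>p ^ (n * k)\<close> elements. On it, \<open>\<sigma>\<close> is the \<open>j\<close>-th power of the Frobenius map for some
  \<open>j\<close>, as it is so on a generator of the multiplicative group. The Frobenius map has order exactly
  \<open>n * k\<close> there, so \<open>\<sigma> ^^ k = id\<close> gives that \<open>n * k\<close> divides \<open>j * k\<close>. Thus \<open>n\<close> divides \<open>j\<close>, and the
  \<open>j\<close>-th power of the Frobenius map fixes \<open>x\<close>.
\<close>
lemma automorphism_torsion_free:
  fixes \<sigma> :: "'a::field \<Rightarrow> 'a"
  assumes char: "Factorial_Ring.prime CHAR('a)"
    and closed: "\<And>q :: 'a poly. Polynomial.degree q > 0 \<Longrightarrow> \<exists>x. poly q x = 0"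
    and union: "\<And>x :: 'a. \<exists>n>0. x \<in> frob_fixed n"
    and \<sigma>: "field_automorphism \<sigma>" and k: "k > 0" "(\<sigma> ^^ k) = id"
  shows "\<sigma> = id"
proof
  fix x :: 'a
  let ?q = "CHAR('a)"
  obtain n where n: "n > 0" "x \<in> frob_fixed n" using union by blast
  define M where "M = n * k"
  have "M > 0" using n k by (simp add: M_def)
  obtain g where g: "g \<in> (frob_fixed M :: 'a set)"
    "\<And>x. x \<in> frob_fixed M \<Longrightarrow> x \<noteq> 0 \<Longrightarrow> \<exists>i. x = g ^ i"
    using frob_fixed_generator[OF char \<open>M > 0\<close>] by blast
  obtain j where j: "\<sigma> g = g ^ (?q ^ j)"
    using automorphism_conjugate[OF char \<sigma> g(1) \<open>M > 0\<close>] by blast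
  have frob: "\<sigma> y = y ^ (?q ^ j)" if "y \<in> frob_fixed M" for y
  proof (cases "y = 0")
    case True
    then show ?thesis using field_automorphism_0[OF \<sigma>] prime_gt_0_nat[OF char] by simp
  next
    case False
    then obtain i where "y = g ^ i" using g(2) \<open>y \<in> frob_fixed M\<close> by blast
    then show ?thesis
      using j by (simp add: field_automorphism_power[OF \<sigma>] mult.commute flip: power_mult)
  qed
  have iter: "(\<sigma> ^^ i) y = y ^ (?q ^ (j * i))" if "y \<in> frob_fixed M" for i y
  proof (induction i)
    case (Suc i)
    then show ?case
      using frob[OF that] by (simp add: field_automorphism_power[OF \<sigma>] power_add power_mult)
  qed simp
  have "frob_fixed M \<subseteq> (frob_fixed (gcd M (j * k)) :: 'a set)"
  proof
    fix y :: 'a assume y: "y \<in> frob_fixed M"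
    then have "y \<in> frob_fixed (j * k)"
      using iter[OF y, of k] k(2) by (simp add: frob_fixed_def)
    then show "y \<in> frob_fixed (gcd M (j * k))"
      using frob_fixed_gcd[OF char y] \<open>M > 0\<close> by simp
  qed
  moreover have "gcd M (j * k) > 0" using \<open>M > 0\<close> by simp
  ultimately have "card (frob_fixed M :: 'a set) \<le> ?q ^ gcd M (j * k)"
    using card_mono[OF finite_frob_fixed[OF char]] card_frob_fixed_le[OF char] le_trans by metis
  moreover have "card (frob_fixed M :: 'a set) = ?q ^ M"
    using card_roots_separable[OF closed frob_poly_nonzero[OF char \<open>M > 0\<close>]]
      pderiv_frob_poly[OF char \<open>M > 0\<close>] degree_frob_poly[OF char \<open>M > 0\<close>]
    by (simp add: roots_frob_poly[OF char])
  \<comment> \<open>A field with \<open>p ^ M\<close> elements does not fit into one with fewer.\<close>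
  ultimately have "M \<le> gcd M (j * k)"
    using prime_gt_1_nat[OF char] by (metis power_increasing_iff)
  then have "gcd M (j * k) = M" using \<open>M > 0\<close> by (simp add: antisym dvd_imp_le)
  then have "n * k dvd j * k" using gcd_dvd2[of M "j * k"] by (simp add: M_def)
  then have "n dvd j" using k by simp
  then obtain i where "j = n * i" by (rule dvdE)
  then have "x ^ (?q ^ j) = x"
    using frob_fixed_power_mult[OF char n(2), of i] by (simp add: frob_fixed_def)
  then show "\<sigma> x = id x"
    using frob[of x] frob_fixed_power_mult[OF char n(2), of k] by (simp add: M_def)
qed

section \<open>Semilinear maps\<close>

lemma finite_subset_frob_fixed:
  assumes char: "Factorial_Ring.prime CHAR('a::field)"
    and union: "\<And>x :: 'a. \<exists>n>0. x \<in> frob_fixed n"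
    and "finite (C :: 'a set)"
  shows "\<exists>n>0. C \<subseteq> frob_fixed n"
  using assms(3)
proof induction
  case (insert x C)
  then obtain n where n: "n > 0" "C \<subseteq> frob_fixed n" by blast
  obtain k where k: "k > 0" "x \<in> frob_fixed k" using union by blast
  have "insert x C \<subseteq> frob_fixed (n * k)"
    using frob_fixed_power_mult[OF char _, of _ n k] n(2)
      frob_fixed_power_mult[OF char k(2), of n] by (auto simp: mult.commute)
  then show ?case using n k by (intro exI[of _ "n * k"]) simp
qed auto

lemma semilinear_coordinates:
  fixes f :: "'a::field ^ 'n::finite \<Rightarrow> 'a ^ 'n"
  assumes add: "\<And>u v. f (u + v) = f u + f v" and scale: "\<And>c v. f (c *s v) = \<sigma> c *s f v"
  shows "f v $ i = (\<Sum>j\<in>UNIV. \<sigma> (v $ j) * f (axis j 1) $ i)"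
proof -
  have "f 0 = 0" using add[of 0 0] by simp
  then have f_sum: "f (sum g I) = (\<Sum>j\<in>I. f (g j))" for g :: "'n \<Rightarrow> 'a ^ 'n" and I
    by (induction I rule: infinite_finite_induct) (simp_all add: add)
  have "f v = f (\<Sum>j\<in>UNIV. v $ j *s axis j 1)" by (simp only: basis_expansion)
  also have "\<dots> = (\<Sum>j\<in>UNIV. \<sigma> (v $ j) *s f (axis j 1))" by (simp only: f_sum scale)
  finally show ?thesis by simp
qed

text \<open>
  All coordinates in question lie in one finite subfield, which \<open>\<sigma>\<close> maps to itself. So \<open>f\<close> acts on
  the finitely many vectors with coordinates in that subfield.
\<close>
lemma finite_orbit_semilinear:
  fixes f :: "'a::field ^ 'n::finite \<Rightarrow> 'a ^ 'n"
  assumes char: "Factorial_Ring.prime CHAR('a)"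
    and union: "\<And>x :: 'a. \<exists>n>0. x \<in> frob_fixed n"
    and \<sigma>: "field_automorphism \<sigma>"
    and add: "\<And>u v. f (u + v) = f u + f v" and scale: "\<And>c v. f (c *s v) = \<sigma> c *s f v"
    and "inj f"
  shows "\<exists>k>0. (f ^^ k) v = v"
proof -
  define C where "C = range (\<lambda>(i, j). f (axis j 1) $ i) \<union> range (\<lambda>i. v $ i)"
  have "finite C" by (simp add: C_def)
  then obtain n where "n > 0" and n: "C \<subseteq> frob_fixed n"
    using finite_subset_frob_fixed[OF char union] by blast
  define W where "W = {w :: 'a ^ 'n. \<forall>i. w $ i \<in> frob_fixed n}"
  have "v \<in> W" using n by (auto simp: W_def C_def)
  have step: "f w \<in> W" if w: "w \<in> W" for w
  proof -
    have "\<sigma> (w $ j) \<in> frob_fixed n" for j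
      using w field_automorphism_power[OF \<sigma>, of "w $ j" "CHAR('a) ^ n"]
      by (simp add: W_def frob_fixed_def)
    moreover have "f (axis j 1) $ i \<in> frob_fixed n" for i j
      using n by (auto simp: C_def)
    ultimately have "(\<Sum>j\<in>UNIV. \<sigma> (w $ j) * f (axis j 1) $ i) \<in> frob_fixed n" for i
      by (intro frob_fixed_sum[OF char] frob_fixed_mult[OF char])
    then have "f w $ i \<in> frob_fixed n" for i
      by (subst semilinear_coordinates[of f, OF add scale])
    then show ?thesis by (simp add: W_def)
  qed
  have "finite W"
  proof (rule finite_subset)
    show "W \<subseteq> vec_lambda ` (UNIV \<rightarrow>\<^sub>E frob_fixed n)"
    proof
      fix w assume "w \<in> W"
      then have "vec_nth w \<in> UNIV \<rightarrow>\<^sub>E frob_fixed n" by (auto simp: W_def PiE_UNIV_domain)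
      then show "w \<in> vec_lambda ` (UNIV \<rightarrow>\<^sub>E frob_fixed n)"
        by (metis image_eqI vec_nth_inverse)
    qed
    show "finite (vec_lambda ` (UNIV \<rightarrow>\<^sub>E frob_fixed n) :: ('a ^ 'n) set)"
      using finite_frob_fixed[OF char \<open>n > 0\<close>] by (intro finite_imageI finite_PiE) auto
  qed
  have "(f ^^ k) v \<in> W" for k
    by (induction k) (simp_all add: \<open>v \<in> W\<close> step)
  then have "finite {y. \<exists>k. y = (f ^^ k) v}"
    using \<open>finite W\<close> by (auto elim!: finite_subset[rotated])
  then show ?thesis using funpow_inj_finite[OF \<open>inj f\<close>] by blast
qed

lemma span_singleton_proj_point: "v \<noteq> 0 \<Longrightarrow> vec.span {v} \<in> proj_points"
  for v :: "'a::field ^ 'n::finite"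
  by (simp add: proj_points_def)

text \<open>
  Let polynomials act on the vector \<open>u\<close> through \<open>f\<close>. The polynomial \<open>X ^ k - c\<close> annihilates \<open>u\<close>;
  take a nonzero annihilating polynomial of least degree and split off a root \<open>a\<close> of it. The cofactor does
  not annihilate \<open>u\<close>, and the vector to which it sends \<open>u\<close> is an eigenvector for \<open>a\<close>.
\<close>
lemma eigenvector_of_funpow_scalar:
  fixes f :: "'a::field ^ 'n::finite \<Rightarrow> 'a ^ 'n"
  assumes closed: "\<And>q :: 'a poly. Polynomial.degree q > 0 \<Longrightarrow> \<exists>x. poly q x = 0"
    and add: "\<And>u v. f (u + v) = f u + f v" and scale: "\<And>c v. f (c *s v) = c *s f v"
    and k: "k > 0" "f ^^ k = (\<lambda>v. c *s v)" and "(u :: 'a ^ 'n) \<noteq> 0"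
  obtains v a where "v \<noteq> 0" "f v = a *s v"
proof -
  have f0: "f 0 = 0" using add[of 0 0] by simp
  define act :: "'a poly \<Rightarrow> 'a ^ 'n" where
    "act q = (\<Sum>i\<le>Polynomial.degree q. Polynomial.coeff q i *s (f ^^ i) u)" for q
  have act: "act q = (\<Sum>i\<le>d. Polynomial.coeff q i *s (f ^^ i) u)" if "Polynomial.degree q \<le> d" for q d
    unfolding act_def using that
    by (intro sum.mono_neutral_left) (auto simp: coeff_eq_0)
  have f_sum: "f (sum g I) = (\<Sum>i\<in>I. f (g i))" for g :: "nat \<Rightarrow> 'a ^ 'n" and I
    by (induction I rule: infinite_finite_induct) (simp_all add: add f0)
  have act_linear: "act ([:-a, 1:] * q) = f (act q) - a *s act q" for a q
  proof -
    let ?d = "Polynomial.degree q"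
    have "act (pCons 0 q) = (\<Sum>i\<le>Suc ?d. Polynomial.coeff (pCons 0 q) i *s (f ^^ i) u)"
      by (rule act) (rule degree_pCons_le)
    also have "\<dots> = f (act q)"
      by (simp add: sum.atMost_Suc_shift act_def f_sum scale del: sum.atMost_Suc)
    finally have X_mult: "act (pCons 0 q) = f (act q)" .
    have "act ([:-a, 1:] * q) =
        (\<Sum>i\<le>Suc ?d. Polynomial.coeff (pCons 0 q - Polynomial.smult a q) i *s (f ^^ i) u)"
      by (subst act[of _ "Suc ?d"])
         (auto intro!: degree_diff_le degree_pCons_le order_trans[OF degree_smult_le])
    also have "\<dots> = act (pCons 0 q) - a *s act q"
      by (subst act[of "pCons 0 q" "Suc ?d"], rule degree_pCons_le, subst act[of q "Suc ?d"])
         (simp_all add: sum_subtractf vec.scale_sum_right vec.scale_left_diff_distrib)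
    finally show ?thesis using X_mult by simp
  qed
  define A where "A = {q. q \<noteq> 0 \<and> act q = 0}"
  have "Polynomial.monom 1 k - [:c:] \<in> A"
  proof -
    have deg: "Polynomial.degree (Polynomial.monom 1 k - [:c:]) \<le> k"
      by (intro degree_diff_le) (auto simp: degree_monom_le)
    have "act (Polynomial.monom 1 k - [:c:]) = (\<Sum>i\<in>{0,k}. Polynomial.coeff (Polynomial.monom 1 k - [:c:]) i *s (f ^^ i) u)"
      unfolding act[OF deg]
      by (intro sum.mono_neutral_right) (auto simp: coeff_pCons split: nat.splits)
    also have "\<dots> = 0" using k by (simp add: coeff_pCons split: nat.splits)
    finally have "act (Polynomial.monom 1 k - [:c:]) = 0" .
    moreover have "Polynomial.coeff (Polynomial.monom 1 k - [:c:]) k \<noteq> 0"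
      using k by (simp add: coeff_pCons split: nat.splits)
    then have "Polynomial.monom 1 k - [:c:] \<noteq> 0" by force
    ultimately show ?thesis by (simp add: A_def)
  qed
  then obtain q where q: "q \<in> A" and min: "\<And>r. r \<in> A \<Longrightarrow> Polynomial.degree q \<le> Polynomial.degree r"
    using ex_has_least_nat[of "\<lambda>q. q \<in> A" _ Polynomial.degree] by blast
  have "Polynomial.degree q > 0"
  proof (rule ccontr)
    assume "\<not> Polynomial.degree q > 0"
    then obtain b where "q = [:b:]" by (auto elim: degree_eq_zeroE)
    then show False using q \<open>u \<noteq> 0\<close> by (simp add: A_def act_def)
  qed
  then obtain a where "poly q a = 0" using closed by blast
  then obtain r where r: "q = [:-a, 1:] * r" by (metis dvdE poly_eq_0_iff_dvd)
  then have "r \<noteq> 0" using q by (auto simp: A_def)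
  then have "Polynomial.degree q = Suc (Polynomial.degree r)"
    unfolding r by (subst degree_mult_eq) auto
  then have "act r \<noteq> 0" using min[of r] \<open>r \<noteq> 0\<close> by (auto simp: A_def)
  moreover have "f (act r) = a *s act r"
    using q act_linear[of a r, folded r] by (simp add: A_def)
  ultimately show ?thesis by (rule that)
qed

section \<open>Singer groups\<close>

lemma image_span_singleton:
  fixes f :: "'a::field ^ 'n::finite \<Rightarrow> 'a ^ 'n"
  assumes "surj \<sigma>" and "\<And>c v. f (c *s v) = \<sigma> c *s f v"
  shows "f ` vec.span {v} = vec.span {f v}"
proof -
  have "f ` vec.span {v} = (\<lambda>c. c *s f v) ` range \<sigma>"
    by (simp add: vec.span_singleton image_image assms(2))
  then show ?thesis by (simp add: vec.span_singleton assms(1))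
qed

lemma funpow_in_GammaL:
  "f \<in> carrier GammaL \<Longrightarrow> f ^^ k \<in> carrier (GammaL :: ('a::field ^ 'n \<Rightarrow> _) monoid)"
proof (induction k)
  case 0
  have "f ^^ 0 = \<one>\<^bsub>GammaL\<^esub>" by (simp add: GammaL_def)
  then show ?case using monoid.one_closed[OF group.is_monoid[OF group_GammaL]] by metis
next
  case (Suc k)
  then have "f \<otimes>\<^bsub>GammaL\<^esub> f ^^ k \<in> carrier GammaL"
    using monoid.m_closed[OF group.is_monoid[OF group_GammaL]] by blast
  moreover have "f \<otimes>\<^bsub>GammaL\<^esub> f ^^ k = f ^^ Suc k" by (simp add: GammaL_def)
  ultimately show ?case by metis
qed

lemma subgroup_PGammaL_cases:
  assumes "subgroup S (PGammaL :: ('a::field ^ 'n \<Rightarrow> _) set monoid)" "g \<in> S"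
  obtains f where "f \<in> carrier GammaL" "g = scalar_maps #>\<^bsub>GammaL\<^esub> f"
  using subgroup.mem_carrier[OF assms] by (auto simp: PGammaL_def carrier_FactGroup)

lemma subgroup_PGammaL_funpow:
  assumes S: "subgroup S (PGammaL :: ('a::field ^ 'n \<Rightarrow> _) set monoid)"
    and f: "f \<in> carrier GammaL" "scalar_maps #>\<^bsub>GammaL\<^esub> f \<in> S"
  shows "scalar_maps #>\<^bsub>GammaL\<^esub> (f ^^ k) \<in> S"
proof (induction k)
  case 0
  have "f ^^ 0 = \<one>\<^bsub>GammaL\<^esub>" by (simp add: GammaL_def)
  moreover have "scalar_maps \<in> S" using subgroup.one_closed[OF S] by (simp add: PGammaL_def)
  ultimately show ?case
    using group.coset_mult_one[OF group_GammaL
        subgroup.subset[OF normal_imp_subgroup[OF normal_scalar_maps]]]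
    by metis
next
  case (Suc k)
  have "(scalar_maps #>\<^bsub>GammaL\<^esub> f) <#>\<^bsub>GammaL\<^esub> (scalar_maps #>\<^bsub>GammaL\<^esub> (f ^^ k)) \<in> S"
    using subgroup.m_closed[OF S f(2) Suc] by (simp add: PGammaL_def)
  then have "scalar_maps #>\<^bsub>GammaL\<^esub> (f \<otimes>\<^bsub>GammaL\<^esub> f ^^ k) \<in> S"
    using normal.rcos_sum[OF normal_scalar_maps f(1) funpow_in_GammaL[OF f(1)]] by simp
  moreover have "f \<otimes>\<^bsub>GammaL\<^esub> f ^^ k = f ^^ Suc k" by (simp add: GammaL_def)
  ultimately show ?case by metis
qed

lemma singer_group_unique:
  assumes "singer_group S" "P \<in> proj_points" "Q \<in> proj_points"
  shows "\<exists>!g. g \<in> S \<and> proj_act g P = Q"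
  by (rule bspec[OF bspec[OF conjunct2[OF assms(1)[unfolded singer_group_def]] assms(2)] assms(3)])

text \<open>
  The element and the identity of \<open>S\<close> both map \<open>P\<close> to \<open>P\<close>, so they coincide.
\<close>
lemma singer_group_fixes_point_imp_one:
  assumes S: "singer_group S" and f: "f \<in> carrier (GammaL :: ('a::field ^ 'n \<Rightarrow> _) monoid)"
    and "scalar_maps #>\<^bsub>GammaL\<^esub> f \<in> S" and P: "P \<in> proj_points" "f ` P = P"
  shows "f \<in> scalar_maps"
proof -
  have sub: "subgroup S PGammaL" using S by (simp add: singer_group_def)
  note uniq = singer_group_unique[OF S P(1) P(1)]
  have coset0: "scalar_maps #>\<^bsub>GammaL\<^esub> (f ^^ 0) \<in> S"
    by (rule subgroup_PGammaL_funpow[OF sub f assms(3)])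
  have one: "scalar_maps #>\<^bsub>GammaL\<^esub> (f ^^ 0) \<in> S \<and>
      proj_act (scalar_maps #>\<^bsub>GammaL\<^esub> (f ^^ 0)) P = P"
    using coset0 proj_act_coset[OF funpow_in_GammaL[OF f] P(1), of 0] by simp
  have "scalar_maps #>\<^bsub>GammaL\<^esub> f \<in> S \<and> proj_act (scalar_maps #>\<^bsub>GammaL\<^esub> f) P = P"
    using assms(3) proj_act_coset[OF f P(1)] P(2) by simp
  from the1_equality[OF uniq this] the1_equality[OF uniq one]
  have "scalar_maps #>\<^bsub>GammaL\<^esub> f = scalar_maps #>\<^bsub>GammaL\<^esub> (f ^^ 0)" by (rule trans[OF sym])
  moreover have "f \<in> scalar_maps #>\<^bsub>GammaL\<^esub> f"
    by (rule group.rcos_self[OF group_GammaL f normal_imp_subgroup[OF normal_scalar_maps]])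
  ultimately have "f \<in> scalar_maps #>\<^bsub>GammaL\<^esub> (f ^^ 0)" by blast
  then obtain h where "h \<in> scalar_maps" "f = h \<circ> id"
    unfolding r_coset_def by (auto simp: GammaL_def)
  then show ?thesis by simp
qed

text \<open>
  The vectors \<open>axis i 1\<close> and \<open>axis j 1\<close> span two points, and the element of \<open>S\<close> that maps one
  to the other turns out to be the identity: one of its powers fixes a point and is thus a scalar
  map, so its companion automorphism has finite order and is the identity, and then it has an
  eigenvector.
\<close>
lemma no_singer_group:
  assumes char: "Factorial_Ring.prime CHAR('a::field)"
    and closed: "\<And>q :: 'a poly. Polynomial.degree q > 0 \<Longrightarrow> \<exists>x. poly q x = 0"
    and union: "\<And>x :: 'a. \<exists>n>0. x \<in> frob_fixed n"
    and card: "CARD('n::finite) \<ge> 2"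
  shows "\<not> singer_group (S :: ('a ^ 'n \<Rightarrow> 'a ^ 'n) set set)"
proof
  assume S: "singer_group S"
  then have sub: "subgroup S PGammaL" by (simp add: singer_group_def)
  obtain i j :: 'n where "i \<noteq> j"
    using card card_le_Suc0_iff_eq[of "UNIV :: 'n set"] by auto
  define e :: "'a ^ 'n" where "e = axis i 1"
  define P where "P = vec.span {e}"
  define Q where "Q = vec.span {axis j 1 :: 'a ^ 'n}"
  have nz: "e \<noteq> 0" "axis j 1 \<noteq> (0 :: 'a ^ 'n)" by (simp_all add: e_def axis_eq_0_iff)
  have PQ: "P \<in> proj_points" "Q \<in> proj_points"
    using nz by (simp_all add: P_def Q_def span_singleton_proj_point)
  have "e \<in> P" by (simp add: P_def vec.span_base)
  moreover have "e \<notin> Q"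
  proof
    assume "e \<in> Q"
    then obtain c where "e = c *s axis j 1" by (auto simp: Q_def vec.span_singleton)
    then have "e $ i = (c *s axis j 1) $ i" by simp
    then show False using \<open>i \<noteq> j\<close> by (simp add: e_def axis_def)
  qed
  ultimately have "P \<noteq> Q" by blast
  obtain g where g: "g \<in> S" "proj_act g P = Q"
    using ex1_implies_ex[OF singer_group_unique[OF S PQ]] by blast
  obtain f where f: "f \<in> carrier GammaL" and gf: "g = scalar_maps #>\<^bsub>GammaL\<^esub> f"
    using subgroup_PGammaL_cases[OF sub g(1)] by blast
  obtain \<sigma> where \<sigma>: "field_automorphism \<sigma>" and scale: "\<And>c v. f (c *s v) = \<sigma> c *s f v"
    and add: "\<And>u v. f (u + v) = f u + f v" and "bij f"
    using f by (auto simp: GammaL_def semilinear_def)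
  have "surj \<sigma>" using \<sigma> by (simp add: field_automorphism_def bij_is_surj)
  obtain k where k: "k > 0" "(f ^^ k) e = e"
    using finite_orbit_semilinear[OF char union \<sigma> add scale bij_is_inj[OF \<open>bij f\<close>]] by blast
  have scale_k: "(f ^^ l) (c *s v) = (\<sigma> ^^ l) c *s (f ^^ l) v" for l c v
    by (induction l) (simp_all add: scale)
  have "surj (\<sigma> ^^ k)" using \<open>surj \<sigma>\<close> by (rule surj_fn)
  then have "(f ^^ k) ` P = P"
    using image_span_singleton[of "\<sigma> ^^ k" "f ^^ k" e, OF _ scale_k]
    unfolding P_def k(2) by blast
  then have "f ^^ k \<in> scalar_maps"
    using singer_group_fixes_point_imp_one[OF S funpow_in_GammaL[OF f] _ PQ(1)]
      subgroup_PGammaL_funpow[OF sub f] g(1) gf by blast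
  then obtain c where c: "c \<noteq> 0" "f ^^ k = (\<lambda>v. c *s v)" by (auto simp: scalar_maps_def)
  have "(\<sigma> ^^ k) d = d" for d
  proof -
    have "c * d * e $ i = (\<sigma> ^^ k) d * c * e $ i"
      using arg_cong[OF scale_k[of k d e], of "\<lambda>v. v $ i"] by (simp add: c(2))
    then show ?thesis using c(1) by (simp add: e_def)
  qed
  then have "\<sigma> = id"
    using automorphism_torsion_free[OF char closed union \<sigma> k(1)] by (auto simp: fun_eq_iff)
  then have linear: "f (c *s v) = c *s f v" for c v using scale by simp
  obtain v a where v: "v \<noteq> 0" "f v = a *s v"
    using eigenvector_of_funpow_scalar[OF closed add linear k(1) c(2) nz(1)] by blast
  have "f 0 = 0" using add[of 0 0] by simp
  then have "f v \<noteq> 0" using inj_eq[OF bij_is_inj[OF \<open>bij f\<close>], of v 0] v(1) by simp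
  then have "a \<noteq> 0" using v by auto
  have "f ` vec.span {v} = vec.span {a *s v}"
    using image_span_singleton[OF \<open>surj \<sigma>\<close> scale, of v] v(2) by simp
  also have "\<dots> = vec.span {v}"
    using vec.span_image_scale[of "{v}" "\<lambda>_. a"] \<open>a \<noteq> 0\<close> by simp
  finally have "f \<in> scalar_maps"
    using singer_group_fixes_point_imp_one[OF S f] g(1) gf span_singleton_proj_point[OF v(1)] by blast
  then obtain b where "b \<noteq> 0" "f = (\<lambda>v. b *s v)" by (auto simp: scalar_maps_def)
  then have "f ` P = P"
    unfolding P_def using image_span_singleton[OF \<open>surj \<sigma>\<close> scale, of e]
      vec.span_image_scale[of "{e}" "\<lambda>_. b"] by simp
  moreover have "f ` P = Q" using g(2) gf proj_act_coset[OF f PQ(1)] by simp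
  ultimately show False using \<open>P \<noteq> Q\<close> by simp
qed

section \<open>Algebraic closures as ring records\<close>

lemma ring_of_type_algebra_simps [simp]:
  "carrier (ring_of_type_algebra :: 'a::field ring) = UNIV"
  "x \<oplus>\<^bsub>ring_of_type_algebra\<^esub> y = x + (y :: 'a)"
  "x \<otimes>\<^bsub>ring_of_type_algebra\<^esub> y = x * (y :: 'a)"
  "\<zero>\<^bsub>ring_of_type_algebra\<^esub> = (0 :: 'a)"
  "\<one>\<^bsub>ring_of_type_algebra\<^esub> = (1 :: 'a)"
  by (simp_all add: ring_of_type_algebra_def)

lemma ring_of_type_algebra_pow [simp]:
  "x [^]\<^bsub>ring_of_type_algebra\<^esub> (n :: nat) = (x :: 'a::field) ^ n"
  by (induction n) (simp_all add: mult.commute)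

text \<open>
  Adding \<open>1\<close> to each element of the finite subring permutes it, hence leaves the sum of all its
  elements unchanged; so its cardinality, a prime, is \<open>0\<close> in the field.
\<close>
lemma char_eq_card_subring:
  assumes K: "subring K (ring_of_type_algebra :: 'a::field ring)"
    and "Factorial_Ring.prime (card K)"
  shows "CHAR('a) = card K"
proof -
  have "finite K" using assms(2) by (metis card.infinite not_prime_0)
  have one: "1 \<in> K" and add: "\<And>x y. x \<in> K \<Longrightarrow> y \<in> K \<Longrightarrow> x + y \<in> K"
    using subringE(3,7)[OF K] by simp_all
  have "(\<lambda>x. x + 1) ` K = K"
    using \<open>finite K\<close> by (intro endo_inj_surj) (auto intro: add one)
  then have "(\<Sum>x\<in>K. x) = (\<Sum>x\<in>K. x + 1)"
    using sum.reindex[of "\<lambda>x. x + 1" K "\<lambda>x. x"] by (simp add: inj_on_def)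
  then have "(of_nat (card K) :: 'a) = 0" by (simp add: sum.distrib)
  then have "CHAR('a) dvd card K" by (simp add: of_nat_eq_0_iff_char_dvd)
  moreover have "CHAR('a) \<noteq> 1"
    by (metis of_nat_1 of_nat_CHAR zero_neq_one)
  ultimately show ?thesis using assms(2) by (auto simp: prime_nat_iff)
qed

text \<open>
  Polynomials over a ring record are coefficient lists with the leading coefficient first.
\<close>
lemma eval_rev_coeffs:
  "ring.eval ring_of_type_algebra (rev (coeffs q)) x = poly q (x :: 'a::field)"
proof -
  interpret ring "ring_of_type_algebra :: 'a ring" by (rule ring_from_type_algebra)
  have "eval xs x = poly (Poly (rev xs)) x" for xs :: "'a list"
    by (induction xs) (simp_all add: Poly_append poly_monom add.commute)
  from this[of "rev (coeffs q)"] show ?thesis by simp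
qed

lemma algebraic_closure_poly_root:
  fixes q :: "'a::field poly"
  assumes "algebraic_closure (ring_of_type_algebra :: 'a ring) K" and "Polynomial.degree q > 0"
  shows "\<exists>x. poly q x = 0"
proof -
  interpret algebraic_closure "ring_of_type_algebra :: 'a ring" K by (rule assms(1))
  define P where "P = rev (coeffs q)"
  have "q \<noteq> 0" using assms(2) by auto
  have "P \<in> carrier (poly_ring ring_of_type_algebra)"
    using \<open>q \<noteq> 0\<close>
    by (auto simp: P_def univ_poly_def polynomial_def hd_rev last_coeffs_eq_coeff_degree)
  moreover from this have "size (roots P) = Polynomials.degree P"
    using roots_over_carrier by (simp add: splitted_def)
  moreover have "Polynomials.degree P = Polynomial.degree q"
    using \<open>q \<noteq> 0\<close> by (simp add: P_def length_coeffs_degree)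
  ultimately have P: "P \<in> carrier (poly_ring ring_of_type_algebra)" and "roots P \<noteq> {#}"
    using assms(2) by auto
  then obtain x where "is_root P x"
    using roots_mem_iff_is_root[OF P] by (meson multiset_nonemptyE)
  then have "eval P x = 0" by (simp add: is_root_def)
  then show ?thesis unfolding P_def eval_rev_coeffs by blast
qed

text \<open>
  The powers of \<open>x\<close> lie in the finite ring \<open>K[x]\<close>, so the orbit of \<open>x\<close> under the injective
  Frobenius map is finite and returns to \<open>x\<close>.
\<close>
lemma algebraic_over_finite_imp_frob_fixed:
  fixes x :: "'a::field"
  assumes "algebraic_closure (ring_of_type_algebra :: 'a ring) K" and "finite K"
    and char: "Factorial_Ring.prime CHAR('a)"
  shows "\<exists>n>0. x \<in> frob_fixed n"
proof -
  interpret algebraic_closure "ring_of_type_algebra :: 'a ring" K by (rule assms(1))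
  let ?E = "simple_extension K x"
  have "finite_dimension K ?E"
    using finite_dimension_simple_extension[OF subfield_axioms, of x] algebraic_extension[of x] by simp
  then obtain d where "dimension d K ?E" by (auto simp: finite_dimension_def)
  moreover have "finite E" if "dimension d L E" "finite L" for d L E
    using that
  proof induction
    case (Suc_dim v E d L)
    have "line_extension L v E = (\<lambda>(k, w). k * v + w) ` (L \<times> E)"
      by (auto simp: line_extension_mem_iff image_iff) blast
    then show ?case using Suc_dim by simp
  qed simp
  ultimately have "finite ?E" using \<open>finite K\<close> by blast
  have sub: "subring ?E ring_of_type_algebra"
    by (rule simple_extension_is_subring[OF subfieldE(1)[OF subfield_axioms]]) simp
  have "x \<in> ?E" by (rule simple_extension_mem[OF subfieldE(1)[OF subfield_axioms]]) simp
  define \<phi> :: "'a \<Rightarrow> 'a" where "\<phi> y = y ^ CHAR('a)" for y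
  have iter: "(\<phi> ^^ n) y = y ^ (CHAR('a) ^ n)" for n y
    by (induction n) (simp_all add: \<phi>_def mult.commute flip: power_mult)
  have "inj \<phi>"
  proof (rule injI)
    fix y z assume "\<phi> y = \<phi> z"
    then have "(y - z) ^ CHAR('a) = 0"
      using frob_diff[OF char, of y z 1] by (simp add: \<phi>_def)
    then show "y = z" by simp
  qed
  moreover have "(\<phi> ^^ n) x \<in> ?E" for n
  proof -
    have "x ^ m \<in> ?E" for m
      using subringE(3,6)[OF sub] \<open>x \<in> ?E\<close> by (induction m) simp_all
    then show ?thesis by (simp add: iter)
  qed
  then have "finite {y. \<exists>n. y = (\<phi> ^^ n) x}"
    using \<open>finite ?E\<close> by (auto elim!: finite_subset[rotated])
  ultimately obtain n where "n > 0" "(\<phi> ^^ n) x = x" by (rule funpow_inj_finite)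
  then show ?thesis by (auto simp: frob_fixed_def iter)
qed

theorem theorem9p5:
  fixes p m :: nat
    and K :: "'a::field set"
  assumes "Factorial_Ring.prime p"
    and "card K = p"
    and "algebraic_closure (ring_of_type_algebra :: 'a ring) K"
    and "m \<ge> 1"
    and "CARD('n::finite) = m + 1"
  shows "\<not> (\<exists>S :: ('a ^ 'n \<Rightarrow> 'a ^ 'n) set set. singer_group S) \<and>
         \<not> (\<exists>S :: ('a ^ 3 \<Rightarrow> 'a ^ 3) set set. singer_group S)"
proof -
  have "subfield K (ring_of_type_algebra :: 'a ring)"
    using assms(3) by (simp add: algebraic_closure_def)
  then have "CHAR('a) = p"
    using char_eq_card_subring[of K] assms(1,2) subfieldE(1) by blast
  then have char: "Factorial_Ring.prime CHAR('a)" using assms(1) by simp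
  have "finite K" using assms(1,2) by (metis card.infinite not_prime_0)
  note closure = char algebraic_closure_poly_root[OF assms(3)]
    algebraic_over_finite_imp_frob_fixed[OF assms(3) \<open>finite K\<close> char]
  have "\<not> singer_group S" for S :: "('a ^ 'n \<Rightarrow> 'a ^ 'n) set set"
    by (rule no_singer_group[OF closure]) (use assms(4,5) in simp_all)
  moreover have "\<not> singer_group S" for S :: "('a ^ 3 \<Rightarrow> 'a ^ 3) set set"
    by (rule no_singer_group[OF closure]) simp_all
  ultimately show ?thesis by blast
qed

end
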